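(* Let $\mathcal O\subset\mathbb H$ be a domain as in the context. For every $\gamma\ge0$ there is a constant $C_5>0$, depending at most on $r,q,\kappa,\theta,\rho,\sigma$ and $\gamma$, such that for all $u,v\in H^1(\mathcal O,\mathfrak w)$, $$|a(u,v)|\le C_5\,\|u\|_{H^1(\mathcal O,\mathfrak w)}\left(\|v\|_{H^1(\mathcal O,\mathfrak w)}+\|y^{-1/2}v\|_{L^2(\mathcal O,\mathfrak w)}\right).$$ If moreover $b_1=0$, then for all $\gamma\ge0$ and all $u,v\in H^1(\mathcal O,\mathfrak w)$, $$|a(u,v)|\le C_5\,\|u\|_{H^1(\mathcal O,\mathfrak w)}\|v\|_{H^1(\mathcal O,\mathfrak w)} .$$
   Context: $\mathbb H=\mathbb R\times(0,\infty)$ with coordinates $(x,y)$. The constants satisfy $\sigma\ne0$, $-1<\rho<1$, $\kappa>0$, $\theta>0$, $r\ge0$, $q\ge0$. Put $\beta=2\kappa\theta/\sigma^2$, $\mu=2\kappa/\sigma^2$, $a_1=\kappa\rho/\sigma-\tfrac12$, $b_1=r-q-\kappa\theta\rho/\sigma$ (not assumed to vanish unless stated), and $\mathfrak w(x,y)=y^{\beta-1}e^{-\gamma|x|-\mu y}$ on $\mathbb H$. $\mathcal O\subset\mathbb H$ is a possibly unbounded domain such that the interior $\Gamma_0$ (in $\{y=0\}$) of $\{y=0\}\cap\partial\mathcal O$ is non-empty. $L^2(\mathcal O,\mathfrak w)$ is the $L^2$ space for the measure $\mathfrak w\,dx\,dy$. With distributional derivatives, $H^1(\mathcal O,\mathfrak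 w)$ is the space of $u$ with finite norm $$\|u\|_{H^1(\mathcal O,\mathfrak w)}^2=\int_{\mathcal O}\left(y|Du|^2+(1+y)u^2\right)\mathfrak w\,dx\,dy .$$ The Heston bilinear form is, for $u,v\in H^1(\mathcal O,\mathfrak w)$ (for which the integrals make sense; the first estimate is vacuous when $\|y^{-1/2}v\|_{L^2(\mathcal O,\mathfrak w)}=\infty$), $$a(u,v)=\tfrac12\int_{\mathcal O}\left(u_xv_x+\rho\sigma u_yv_x+\rho\sigma u_xv_y+\sigma^2u_yv_y\right)y\,\mathfrak w\,dx\,dy-\tfrac\gamma2\int_{\mathcal O}(u_x+\rho\sigma u_y)v\,\operatorname{sign}(x)\,y\,\mathfrak w\,dx\,dy$$ $$\qquad-\int_{\mathcal O}(a_1y+b_1)u_xv\,\mathfrak w\,dx\,dy+\int_{\mathcal O}ruv\,\mathfrak w\,dx\,dy .$$ *)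

theory Defs
  imports "HOL-Analysis.Analysis"
begin

section \<open>Distributional derivatives on open subsets of the plane\<close>

text \<open>
  Points of the plane are pairs \<open>(x, y)\<close>; the coordinate directions are
  \<open>(1, 0)\<close> and \<open>(0, 1)\<close>, i.e. the elements of \<open>Basis\<close>.
\<close>

definition pderiv_dir :: "real \<times> real \<Rightarrow> (real \<times> real \<Rightarrow> real) \<Rightarrow> real \<times> real \<Rightarrow> real" where
  "pderiv_dir e f z = frechet_derivative f (at z) e"

primrec Ck_fun :: "nat \<Rightarrow> (real \<times> real \<Rightarrow> real) \<Rightarrow> bool" where
  "Ck_fun 0 f \<longleftrightarrow> continuous_on UNIV f"
| "Ck_fun (Suc k) f \<longleftrightarrow>
     (\<forall>z. f differentiable (at z)) \<and> (\<forall>e\<in>Basis. Ck_fun k (pderiv_dir e f))"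

definition test_fun :: "(real \<times> real) set \<Rightarrow> (real \<times> real \<Rightarrow> real) \<Rightarrow> bool" where
  "test_fun \<Omega> \<phi> \<longleftrightarrow>
     (\<forall>k. Ck_fun k \<phi>) \<and> compact (closure {z. \<phi> z \<noteq> 0}) \<and> closure {z. \<phi> z \<noteq> 0} \<subseteq> \<Omega>"

definition locally_integrable :: "(real \<times> real) set \<Rightarrow> (real \<times> real \<Rightarrow> real) \<Rightarrow> bool" where
  "locally_integrable \<Omega> f \<longleftrightarrow>
     f \<in> borel_measurable (lebesgue_on \<Omega>) \<and>
     (\<forall>K. compact K \<and> K \<subseteq> \<Omega> \<longrightarrow> integrable (lebesgue_on K) f)"

definition has_weak_deriv ::
  "(real \<times> real) set \<Rightarrow> real \<times> real \<Rightarrow> (real \<times> real \<Rightarrow> real) \<Rightarrow> (real \<times> real \<Rightarrow> real) \<Rightarrow> bool" where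
  "has_weak_deriv \<Omega> e u g \<longleftrightarrow>
     locally_integrable \<Omega> u \<and> locally_integrable \<Omega> g \<and>
     (\<forall>\<phi>. test_fun \<Omega> \<phi> \<longrightarrow>
        (LINT z|lebesgue_on \<Omega>. u z * pderiv_dir e \<phi> z) = - (LINT z|lebesgue_on \<Omega>. g z * \<phi> z))"

text \<open>
  The weak derivative is determined only up to null sets; every use below is inside an
  integral over the same domain, so the choice of representative does not matter.
\<close>

definition weak_deriv ::
  "(real \<times> real) set \<Rightarrow> real \<times> real \<Rightarrow> (real \<times> real \<Rightarrow> real) \<Rightarrow> real \<times> real \<Rightarrow> real" where
  "weak_deriv \<Omega> e u = (SOME g. has_weak_deriv \<Omega> e u g)"

abbreviation weak_dx :: "(real \<times> real) set \<Rightarrow> (real \<times> real \<Rightarrow> real) \<Rightarrow> real \<times> real \<Rightarrow> real" where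
  "weak_dx \<Omega> u \<equiv> weak_deriv \<Omega> (1, 0) u"

abbreviation weak_dy :: "(real \<times> real) set \<Rightarrow> (real \<times> real \<Rightarrow> real) \<Rightarrow> real \<times> real \<Rightarrow> real" where
  "weak_dy \<Omega> u \<equiv> weak_deriv \<Omega> (0, 1) u"


section \<open>Domains and Heston coefficients\<close>

definition upper_half_plane :: "(real \<times> real) set" where
  "upper_half_plane = UNIV \<times> {0<..}"

definition heston_domain :: "(real \<times> real) set \<Rightarrow> bool" where
  "heston_domain \<Omega> \<longleftrightarrow>
     open \<Omega> \<and> connected \<Omega> \<and> \<Omega> \<noteq> {} \<and> \<Omega> \<subseteq> upper_half_plane \<and>
     (top_of_set {z. snd z = 0}) interior_of ({z. snd z = 0} \<inter> frontier \<Omega>) \<noteq> {}"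

definition heston_beta :: "real \<Rightarrow> real \<Rightarrow> real \<Rightarrow> real" where
  "heston_beta \<sigma> \<kappa> \<theta> = 2 * \<kappa> * \<theta> / \<sigma>\<^sup>2"

definition heston_mu :: "real \<Rightarrow> real \<Rightarrow> real" where
  "heston_mu \<sigma> \<kappa> = 2 * \<kappa> / \<sigma>\<^sup>2"

definition heston_a1 :: "real \<Rightarrow> real \<Rightarrow> real \<Rightarrow> real" where
  "heston_a1 \<sigma> \<rho> \<kappa> = \<kappa> * \<rho> / \<sigma> - 1 / 2"

definition heston_b1 :: "real \<Rightarrow> real \<Rightarrow> real \<Rightarrow> real \<Rightarrow> real \<Rightarrow> real \<Rightarrow> real" where
  "heston_b1 \<sigma> \<rho> \<kappa> \<theta> r q = r - q - \<kappa> * \<theta> * \<rho> / \<sigma>"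

definition heston_weight :: "real \<Rightarrow> real \<Rightarrow> real \<Rightarrow> real \<Rightarrow> real \<times> real \<Rightarrow> real" where
  "heston_weight \<sigma> \<kappa> \<theta> \<gamma> = (\<lambda>(x, y).
     y powr (heston_beta \<sigma> \<kappa> \<theta> - 1) * exp (- \<gamma> * \<bar>x\<bar> - heston_mu \<sigma> \<kappa> * y))"

definition heston_measure ::
  "real \<Rightarrow> real \<Rightarrow> real \<Rightarrow> real \<Rightarrow> (real \<times> real) set \<Rightarrow> (real \<times> real) measure" where
  "heston_measure \<sigma> \<kappa> \<theta> \<gamma> \<Omega> =
     density (lebesgue_on \<Omega>) (\<lambda>z. ennreal (heston_weight \<sigma> \<kappa> \<theta> \<gamma> z))"


section \<open>Weighted spaces\<close>

text \<open>
  In this section \<open>M\<close> stands for the weighted measure on \<open>\<Omega>\<close>. Elements of the spaces are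
  functions rather than almost-everywhere classes; values outside \<open>\<Omega>\<close> are irrelevant.
  The norms are meaningful only on the corresponding spaces, since a divergent Bochner
  integral evaluates to \<open>0\<close>.
\<close>

definition L2_space :: "(real \<times> real) measure \<Rightarrow> (real \<times> real \<Rightarrow> real) set" where
  "L2_space M = {f. f \<in> borel_measurable M \<and> integrable M (\<lambda>z. (f z)\<^sup>2)}"

definition L2_norm :: "(real \<times> real) measure \<Rightarrow> (real \<times> real \<Rightarrow> real) \<Rightarrow> real" where
  "L2_norm M f = sqrt (LINT z|M. (f z)\<^sup>2)"

definition H1_density ::
  "(real \<times> real) set \<Rightarrow> (real \<times> real \<Rightarrow> real) \<Rightarrow> real \<times> real \<Rightarrow> real" where
  "H1_density \<Omega> u z =
     snd z * ((weak_dx \<Omega> u z)\<^sup>2 + (weak_dy \<Omega> u z)\<^sup>2) + (1 + snd z) * (u z)\<^sup>2"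

definition H1_space ::
  "(real \<times> real) measure \<Rightarrow> (real \<times> real) set \<Rightarrow> (real \<times> real \<Rightarrow> real) set" where
  "H1_space M \<Omega> = {u.
     (\<forall>e\<in>Basis. \<exists>g. has_weak_deriv \<Omega> e u g) \<and> integrable M (H1_density \<Omega> u)}"

definition H1_norm ::
  "(real \<times> real) measure \<Rightarrow> (real \<times> real) set \<Rightarrow> (real \<times> real \<Rightarrow> real) \<Rightarrow> real" where
  "H1_norm M \<Omega> u = sqrt (LINT z|M. H1_density \<Omega> u z)"


section \<open>The Heston bilinear form\<close>

definition heston_integrand1 where
  "heston_integrand1 \<sigma> \<rho> \<Omega> u v z =
     (weak_dx \<Omega> u z * weak_dx \<Omega> v z + \<rho> * \<sigma> * weak_dy \<Omega> u z * weak_dx \<Omega> v z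
      + \<rho> * \<sigma> * weak_dx \<Omega> u z * weak_dy \<Omega> v z + \<sigma>\<^sup>2 * weak_dy \<Omega> u z * weak_dy \<Omega> v z) * snd z"

definition heston_integrand2 where
  "heston_integrand2 \<sigma> \<rho> \<Omega> u v z =
     (weak_dx \<Omega> u z + \<rho> * \<sigma> * weak_dy \<Omega> u z) * v z * sgn (fst z) * snd z"

definition heston_integrand3 where
  "heston_integrand3 \<sigma> \<rho> \<kappa> \<theta> r q \<Omega> u v z =
     (heston_a1 \<sigma> \<rho> \<kappa> * snd z + heston_b1 \<sigma> \<rho> \<kappa> \<theta> r q) * weak_dx \<Omega> u z * v z"

definition heston_integrand4 :: "real \<Rightarrow> (real \<times> real \<Rightarrow> real) \<Rightarrow> (real \<times> real \<Rightarrow> real) \<Rightarrow> real \<times> real \<Rightarrow> real" where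
  "heston_integrand4 r u v z = r * u z * v z"

definition heston_form ::
  "real \<Rightarrow> real \<Rightarrow> real \<Rightarrow> real \<Rightarrow> real \<Rightarrow> real \<Rightarrow> real \<Rightarrow> (real \<times> real) set \<Rightarrow>
   (real \<times> real \<Rightarrow> real) \<Rightarrow> (real \<times> real \<Rightarrow> real) \<Rightarrow> real" where
  "heston_form \<sigma> \<rho> \<kappa> \<theta> r q \<gamma> \<Omega> u v = (let M = heston_measure \<sigma> \<kappa> \<theta> \<gamma> \<Omega> in
     1 / 2 * (LINT z|M. heston_integrand1 \<sigma> \<rho> \<Omega> u v z)
     - \<gamma> / 2 * (LINT z|M. heston_integrand2 \<sigma> \<rho> \<Omega> u v z)
     - (LINT z|M. heston_integrand3 \<sigma> \<rho> \<kappa> \<theta> r q \<Omega> u v z)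
     + (LINT z|M. heston_integrand4 r u v z))"

text \<open>Since divergent Bochner integrals evaluate to \<open>0\<close>, \<open>heston_form\<close> is meaningful only under this condition.\<close>

definition heston_form_defined ::
  "real \<Rightarrow> real \<Rightarrow> real \<Rightarrow> real \<Rightarrow> real \<Rightarrow> real \<Rightarrow> real \<Rightarrow> (real \<times> real) set \<Rightarrow>
   (real \<times> real \<Rightarrow> real) \<Rightarrow> (real \<times> real \<Rightarrow> real) \<Rightarrow> bool" where
  "heston_form_defined \<sigma> \<rho> \<kappa> \<theta> r q \<gamma> \<Omega> u v \<longleftrightarrow> (let M = heston_measure \<sigma> \<kappa> \<theta> \<gamma> \<Omega> in
     integrable M (heston_integrand1 \<sigma> \<rho> \<Omega> u v) \<and>
     integrable M (heston_integrand2 \<sigma> \<rho> \<Omega> u v) \<and>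
     integrable M (heston_integrand3 \<sigma> \<rho> \<kappa> \<theta> r q \<Omega> u v) \<and>
     integrable M (heston_integrand4 r u v))"

end

theory Submission
  imports Defs
begin

text \<open>
  Every integrand of the form is a linear combination, with bounded coefficients, of products in
  which, up to one exception, one factor is
  \<open>\<surd>y u\<^sub>x\<close>, \<open>\<surd>y u\<^sub>y\<close> or \<open>u\<close>, and the other is \<open>\<surd>y v\<^sub>x\<close>, \<open>\<surd>y v\<^sub>y\<close>, \<open>\<surd>y v\<close> or \<open>v\<close>: the weight \<open>y\<close> in
  the first two integrals and in \<open>a\<^sub>1 y u\<^sub>x v\<close> is shared equally between the two factors. The squares
  of all these factors are summands of the \<open>H\<^sup>1\<close> densities, so each factor is at most \<open>P = \<surd>density(u)\<close>
  or \<open>Q = \<surd>density(v)\<close> pointwise, and Cauchy--Schwarz bounds \<open>\<integral> P Q\<close> by the product of the \<open>H\<^sup>1\<close>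
  norms.

  The exception is \<open>b\<^sub>1 u\<^sub>x v\<close>, which carries no power of \<open>y\<close>. It is split as
  \<open>b\<^sub>1 (\<surd>y u\<^sub>x) (y\<^sup>-\<^sup>1\<^sup>/\<^sup>2 v)\<close>, which costs the extra norm of \<open>y\<^sup>-\<^sup>1\<^sup>/\<^sup>2 v\<close> and disappears when \<open>b\<^sub>1 = 0\<close>.

  The domination by \<open>P\<close> and \<open>Q\<close> holds pointwise where \<open>y > 0\<close>, so it also gives the integrability of
  the integrands, and it makes the constant depend on the coefficients alone and not on the domain.
\<close>

section \<open>Integrals dominated by products of square-integrable functions\<close>

lemma L2_product_integrable:
  assumes "f \<in> L2_space M" "g \<in> L2_space M"
  shows "integrable M (\<lambda>z. f z * g z)"
proof (rule Bochner_Integration.integrable_bound)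
  show "integrable M (\<lambda>z. (f z)\<^sup>2 + (g z)\<^sup>2)"
    using assms by (auto simp: L2_space_def)
  show "(\<lambda>z. f z * g z) \<in> borel_measurable M"
    using assms by (auto simp: L2_space_def)
  have "\<bar>a * b\<bar> \<le> a\<^sup>2 + b\<^sup>2" for a b :: real
  proof -
    have "2 * \<bar>a * b\<bar> \<le> a\<^sup>2 + b\<^sup>2"
      using sum_squares_bound[of "\<bar>a\<bar>" "\<bar>b\<bar>"] by (simp add: abs_mult)
    then show ?thesis
      by linarith
  qed
  then show "AE z in M. norm (f z * g z) \<le> norm ((f z)\<^sup>2 + (g z)\<^sup>2)"
    by simp
qed

lemma L2_norm_nonneg: "0 \<le> L2_norm M f"
  by (simp add: L2_norm_def)

lemma Cauchy_Schwarz_L2: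
  assumes f: "f \<in> L2_space M" and g: "g \<in> L2_space M"
  shows "(LINT z|M. \<bar>f z * g z\<bar>) \<le> L2_norm M f * L2_norm M g"
proof -
  have [measurable]: "f \<in> borel_measurable M" "g \<in> borel_measurable M"
    and sq: "integrable M (\<lambda>z. (f z)\<^sup>2)" "integrable M (\<lambda>z. (g z)\<^sup>2)"
    using f g by (auto simp: L2_space_def)
  have prod: "integrable M (\<lambda>z. \<bar>f z * g z\<bar>)"
    using L2_product_integrable[OF f g] by simp
  have "(\<integral>\<^sup>+z. ennreal \<bar>f z\<bar> * ennreal \<bar>g z\<bar> \<partial>M)\<^sup>2
        \<le> (\<integral>\<^sup>+z. (ennreal \<bar>f z\<bar>)\<^sup>2 \<partial>M) * (\<integral>\<^sup>+z. (ennreal \<bar>g z\<bar>)\<^sup>2 \<partial>M)"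
    by (rule Cauchy_Schwarz_nn_integral) auto
  also have "(\<integral>\<^sup>+z. ennreal \<bar>f z\<bar> * ennreal \<bar>g z\<bar> \<partial>M) = ennreal (LINT z|M. \<bar>f z * g z\<bar>)"
    using nn_integral_eq_integral[OF prod] by (simp add: abs_mult ennreal_mult)
  also have "(\<integral>\<^sup>+z. (ennreal \<bar>f z\<bar>)\<^sup>2 \<partial>M) = ennreal (LINT z|M. (f z)\<^sup>2)"
    using nn_integral_eq_integral[OF sq(1)] by (simp add: ennreal_power)
  also have "(\<integral>\<^sup>+z. (ennreal \<bar>g z\<bar>)\<^sup>2 \<partial>M) = ennreal (LINT z|M. (g z)\<^sup>2)"
    using nn_integral_eq_integral[OF sq(2)] by (simp add: ennreal_power)
  finally have "ennreal ((LINT z|M. \<bar>f z * g z\<bar>)\<^sup>2)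
      \<le> ennreal ((LINT z|M. (f z)\<^sup>2) * (LINT z|M. (g z)\<^sup>2))"
    by (simp add: ennreal_power ennreal_mult)
  then have "(LINT z|M. \<bar>f z * g z\<bar>)\<^sup>2 \<le> (LINT z|M. (f z)\<^sup>2) * (LINT z|M. (g z)\<^sup>2)"
    by (subst (asm) ennreal_le_iff) auto
  then show ?thesis
    unfolding L2_norm_def real_sqrt_mult[symmetric] by (rule real_le_rsqrt)
qed

text \<open>
  The second product is there for the term \<open>b\<^sub>1 u\<^sub>x v\<close>; both products share the factor \<open>P\<close> that is
  built from \<open>u\<close>.
\<close>
lemma integral_bound_by_products:
  assumes L2: "P \<in> L2_space M" "Q \<in> L2_space M" "S \<in> L2_space M"
    and f: "f \<in> borel_measurable M"
    and le: "\<And>z. z \<in> space M \<Longrightarrow> \<bar>f z\<bar> \<le> c * \<bar>P z * Q z\<bar> + d * \<bar>P z * S z\<bar>"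
    and "0 \<le> c" "0 \<le> d"
  shows "integrable M f"
    and "\<bar>LINT z|M. f z\<bar> \<le> L2_norm M P * (c * L2_norm M Q + d * L2_norm M S)"
proof -
  let ?h = "\<lambda>z. c * \<bar>P z * Q z\<bar> + d * \<bar>P z * S z\<bar>"
  note int = L2_product_integrable[OF L2(1,2)] L2_product_integrable[OF L2(1,3)]
  have h: "integrable M ?h"
    by (intro Bochner_Integration.integrable_add integrable_mult_right integrable_abs int)
  show fi: "integrable M f"
    by (rule Bochner_Integration.integrable_bound[OF h f])
      (auto intro!: AE_I2 order_trans[OF le])
  have "\<bar>LINT z|M. f z\<bar> \<le> (LINT z|M. \<bar>f z\<bar>)"
    by (rule integral_abs_bound)
  also have "\<dots> \<le> (LINT z|M. ?h z)"
    using fi h le by (intro integral_mono) auto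
  also have "\<dots> = c * (LINT z|M. \<bar>P z * Q z\<bar>) + d * (LINT z|M. \<bar>P z * S z\<bar>)"
    using int by (subst Bochner_Integration.integral_add) auto
  also have "\<dots> \<le> c * (L2_norm M P * L2_norm M Q) + d * (L2_norm M P * L2_norm M S)"
    using assms by (intro add_mono mult_left_mono Cauchy_Schwarz_L2)
  finally show "\<bar>LINT z|M. f z\<bar> \<le> L2_norm M P * (c * L2_norm M Q + d * L2_norm M S)"
    by (simp add: algebra_simps)
qed


section \<open>Weighted Sobolev functions\<close>

lemma space_heston_measure [simp]: "space (heston_measure \<sigma> \<kappa> \<theta> \<gamma> \<Omega>) = \<Omega>"
  by (simp add: heston_measure_def)

lemma measurable_heston_measure:
  "borel_measurable (heston_measure \<sigma> \<kappa> \<theta> \<gamma> \<Omega>) = borel_measurable (lebesgue_on \<Omega>)"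
  by (rule measurable_cong_sets) (simp_all add: heston_measure_def)

lemma weak_deriv_measurable:
  assumes "has_weak_deriv \<Omega> e u g"
  shows "weak_deriv \<Omega> e u \<in> borel_measurable (lebesgue_on \<Omega>)"
proof -
  have "has_weak_deriv \<Omega> e u (weak_deriv \<Omega> e u)"
    unfolding weak_deriv_def by (rule someI[where P = "has_weak_deriv \<Omega> e u", OF assms])
  then show ?thesis
    by (simp add: has_weak_deriv_def locally_integrable_def)
qed

lemma H1_space_measurable:
  assumes "u \<in> H1_space M \<Omega>"
  shows "u \<in> borel_measurable (lebesgue_on \<Omega>)"
    and "weak_dx \<Omega> u \<in> borel_measurable (lebesgue_on \<Omega>)"
    and "weak_dy \<Omega> u \<in> borel_measurable (lebesgue_on \<Omega>)"
proof -
  have "(1, 0) \<in> (Basis :: (real \<times> real) set)" "(0, 1) \<in> (Basis :: (real \<times> real) set)"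
    by (auto simp: Basis_prod_def)
  then obtain g h where "has_weak_deriv \<Omega> (1, 0) u g" "has_weak_deriv \<Omega> (0, 1) u h"
    using assms unfolding H1_space_def by blast
  note weak = this
  show "u \<in> borel_measurable (lebesgue_on \<Omega>)"
    using weak(1) by (simp add: has_weak_deriv_def locally_integrable_def)
  show "weak_dx \<Omega> u \<in> borel_measurable (lebesgue_on \<Omega>)"
    "weak_dy \<Omega> u \<in> borel_measurable (lebesgue_on \<Omega>)"
    by (rule weak[THEN weak_deriv_measurable])+
qed

lemma coordinates_measurable:
  "fst \<in> borel_measurable (lebesgue_on (\<Omega> :: (real \<times> real) set))"
  "snd \<in> borel_measurable (lebesgue_on (\<Omega> :: (real \<times> real) set))"
  by (intro measurable_restrict_space1 measurable_completion, simp add: borel_prod[symmetric])+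

lemma H1_density_nonneg: "0 \<le> snd z \<Longrightarrow> 0 \<le> H1_density \<Omega> u z"
  by (simp add: H1_density_def)

lemma sqrt_H1_density_L2:
  assumes "u \<in> H1_space M \<Omega>" "\<And>z. z \<in> space M \<Longrightarrow> 0 \<le> snd z"
  shows "(\<lambda>z. sqrt (H1_density \<Omega> u z)) \<in> L2_space M"
    and "L2_norm M (\<lambda>z. sqrt (H1_density \<Omega> u z)) = H1_norm M \<Omega> u"
proof -
  have int: "integrable M (H1_density \<Omega> u)"
    using assms by (simp add: H1_space_def)
  have sq: "(sqrt (H1_density \<Omega> u z))\<^sup>2 = H1_density \<Omega> u z" if "z \<in> space M" for z
    using assms(2)[OF that] by (simp add: H1_density_nonneg)
  have "integrable M (\<lambda>z. (sqrt (H1_density \<Omega> u z))\<^sup>2)"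
    using int by (subst Bochner_Integration.integrable_cong[OF refl sq]) auto
  then show "(\<lambda>z. sqrt (H1_density \<Omega> u z)) \<in> L2_space M"
    using borel_measurable_integrable[OF int] by (auto simp: L2_space_def)
  show "L2_norm M (\<lambda>z. sqrt (H1_density \<Omega> u z)) = H1_norm M \<Omega> u"
    unfolding L2_norm_def H1_norm_def
    by (subst Bochner_Integration.integral_cong[OF refl sq]) auto
qed

text \<open>Expanded, the density is a sum of four nonnegative terms: the squares of the left-hand sides.\<close>
lemma sqrt_H1_density_ge:
  assumes "0 \<le> snd z"
  shows "sqrt (snd z) * \<bar>weak_dx \<Omega> u z\<bar> \<le> sqrt (H1_density \<Omega> u z)"
    and "sqrt (snd z) * \<bar>weak_dy \<Omega> u z\<bar> \<le> sqrt (H1_density \<Omega> u z)"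
    and "sqrt (snd z) * \<bar>u z\<bar> \<le> sqrt (H1_density \<Omega> u z)"
    and "\<bar>u z\<bar> \<le> sqrt (H1_density \<Omega> u z)"
proof -
  have split: "H1_density \<Omega> u z = snd z * (weak_dx \<Omega> u z)\<^sup>2 + snd z * (weak_dy \<Omega> u z)\<^sup>2
      + snd z * (u z)\<^sup>2 + (u z)\<^sup>2"
    by (simp add: H1_density_def algebra_simps)
  have "0 \<le> snd z * (weak_dx \<Omega> u z)\<^sup>2" "0 \<le> snd z * (weak_dy \<Omega> u z)\<^sup>2"
    "0 \<le> snd z * (u z)\<^sup>2" "0 \<le> (u z)\<^sup>2"
    using assms by auto
  note nonneg = this
  show "sqrt (snd z) * \<bar>weak_dx \<Omega> u z\<bar> \<le> sqrt (H1_density \<Omega> u z)"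
    "sqrt (snd z) * \<bar>weak_dy \<Omega> u z\<bar> \<le> sqrt (H1_density \<Omega> u z)"
    "sqrt (snd z) * \<bar>u z\<bar> \<le> sqrt (H1_density \<Omega> u z)"
    "\<bar>u z\<bar> \<le> sqrt (H1_density \<Omega> u z)"
    using assms nonneg split by (auto intro!: real_le_rsqrt simp: power_mult_distrib)
qed


section \<open>Pointwise bounds on the integrands\<close>

lemma heston_integrand1_le:
  assumes y: "0 \<le> snd z" and rho: "\<bar>\<rho>\<bar> \<le> 1"
  shows "\<bar>heston_integrand1 \<sigma> \<rho> \<Omega> u v z\<bar>
    \<le> (1 + \<bar>\<sigma>\<bar>)\<^sup>2 * (sqrt (H1_density \<Omega> u z) * sqrt (H1_density \<Omega> v z))"
proof -
  define s where "s = sqrt (snd z)"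
  have s: "snd z = s * s" "0 \<le> s"
    using y by (auto simp: s_def)
  define P where "P = sqrt (H1_density \<Omega> u z)"
  define Q where "Q = sqrt (H1_density \<Omega> v z)"
  define a where "a = s * weak_dx \<Omega> u z"
  define b where "b = s * weak_dy \<Omega> u z"
  define c where "c = s * weak_dx \<Omega> v z"
  define d where "d = s * weak_dy \<Omega> v z"
  have le: "\<bar>a\<bar> \<le> P" "\<bar>b\<bar> \<le> P" "\<bar>c\<bar> \<le> Q" "\<bar>d\<bar> \<le> Q"
    using sqrt_H1_density_ge[OF y] s(2)
    by (simp_all add: a_def b_def c_def d_def P_def Q_def s_def abs_mult)
  have mult: "\<bar>t * (p * p')\<bar> \<le> T * (P * Q)"
    if "\<bar>t\<bar> \<le> T" "\<bar>p\<bar> \<le> P" "\<bar>p'\<bar> \<le> Q" for t p p' T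
    unfolding abs_mult using that by (intro mult_mono) auto
  have rs: "\<bar>\<rho> * \<sigma>\<bar> \<le> \<bar>\<sigma>\<bar>"
    using rho by (simp add: abs_mult mult_left_le_one_le)
  have "heston_integrand1 \<sigma> \<rho> \<Omega> u v z
      = 1 * (a * c) + \<rho> * \<sigma> * (b * c) + \<rho> * \<sigma> * (a * d) + \<sigma>\<^sup>2 * (b * d)"
    by (simp add: heston_integrand1_def a_def b_def c_def d_def s(1) algebra_simps)
  also have "\<bar>\<dots>\<bar> \<le> 1 * (P * Q) + \<bar>\<sigma>\<bar> * (P * Q) + \<bar>\<sigma>\<bar> * (P * Q) + \<sigma>\<^sup>2 * (P * Q)"
    by (intro order_trans[OF abs_triangle_ineq] add_mono mult le rs) auto
  also have "\<dots> = (1 + \<bar>\<sigma>\<bar>)\<^sup>2 * (P * Q)"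
    by (simp add: power2_eq_square algebra_simps)
  finally show ?thesis
    by (simp add: P_def Q_def)
qed

lemma heston_integrand2_le:
  assumes y: "0 \<le> snd z" and rho: "\<bar>\<rho>\<bar> \<le> 1"
  shows "\<bar>heston_integrand2 \<sigma> \<rho> \<Omega> u v z\<bar>
    \<le> (1 + \<bar>\<sigma>\<bar>) * (sqrt (H1_density \<Omega> u z) * sqrt (H1_density \<Omega> v z))"
proof -
  define s where "s = sqrt (snd z)"
  have s: "snd z = s * s" "0 \<le> s"
    using y by (auto simp: s_def)
  define P where "P = sqrt (H1_density \<Omega> u z)"
  define Q where "Q = sqrt (H1_density \<Omega> v z)"
  define a where "a = s * weak_dx \<Omega> u z"
  define b where "b = s * weak_dy \<Omega> u z"
  define w where "w = s * v z"
  have le: "\<bar>a\<bar> \<le> P" "\<bar>b\<bar> \<le> P" "\<bar>w\<bar> \<le> Q"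
    using sqrt_H1_density_ge[OF y] s(2)
    by (simp_all add: a_def b_def w_def P_def Q_def s_def abs_mult)
  have "\<bar>\<rho> * \<sigma> * b\<bar> \<le> \<bar>\<sigma>\<bar> * P"
    unfolding abs_mult using rho le
    by (intro mult_mono) (auto simp: mult_left_le_one_le)
  with le have ab: "\<bar>a + \<rho> * \<sigma> * b\<bar> \<le> (1 + \<bar>\<sigma>\<bar>) * P"
    by (simp add: algebra_simps)
  have "heston_integrand2 \<sigma> \<rho> \<Omega> u v z = (a + \<rho> * \<sigma> * b) * w * sgn (fst z)"
    by (simp add: heston_integrand2_def a_def b_def w_def s(1) algebra_simps)
  also have "\<bar>\<dots>\<bar> \<le> \<bar>(a + \<rho> * \<sigma> * b) * w\<bar>"
    by (simp add: abs_mult abs_sgn_eq)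
  also have "\<dots> \<le> ((1 + \<bar>\<sigma>\<bar>) * P) * Q"
    unfolding abs_mult using ab le by (intro mult_mono) auto
  finally show ?thesis
    by (simp add: P_def Q_def mult.assoc)
qed

text \<open>
  The function \<open>w\<close> stands for \<open>y\<^sup>-\<^sup>1\<^sup>/\<^sup>2 v\<close> in general, and for \<open>0\<close> when \<open>b\<^sub>1 = 0\<close>; this way a single
  argument yields both estimates on the form.
\<close>
lemma heston_integrand3_le:
  assumes y: "0 < snd z"
    and w: "heston_b1 \<sigma> \<rho> \<kappa> \<theta> r q = 0 \<or> w = snd z powr (- 1 / 2) * v z"
  shows "\<bar>heston_integrand3 \<sigma> \<rho> \<kappa> \<theta> r q \<Omega> u v z\<bar>
    \<le> \<bar>heston_a1 \<sigma> \<rho> \<kappa>\<bar> * (sqrt (H1_density \<Omega> u z) * sqrt (H1_density \<Omega> v z))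
      + \<bar>heston_b1 \<sigma> \<rho> \<kappa> \<theta> r q\<bar> * (sqrt (H1_density \<Omega> u z) * \<bar>w\<bar>)"
proof -
  define s where "s = sqrt (snd z)"
  have s: "snd z = s * s" "0 < s"
    using y by (auto simp: s_def)
  define P where "P = sqrt (H1_density \<Omega> u z)"
  define Q where "Q = sqrt (H1_density \<Omega> v z)"
  let ?a = "heston_a1 \<sigma> \<rho> \<kappa>" and ?b = "heston_b1 \<sigma> \<rho> \<kappa> \<theta> r q"
  define a where "a = s * weak_dx \<Omega> u z"
  have le: "\<bar>a\<bar> \<le> P" "\<bar>s * v z\<bar> \<le> Q"
    using sqrt_H1_density_ge[OF less_imp_le[OF y]] s(2)
    by (simp_all add: a_def P_def Q_def s_def abs_mult)
  have "snd z powr (- 1 / 2) = 1 / s"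
    using y by (simp add: s_def powr_minus_divide powr_half_sqrt)
  then have b: "?b * weak_dx \<Omega> u z * v z = ?b * (a * w)"
    using w s(2) by (auto simp: a_def)
  have "heston_integrand3 \<sigma> \<rho> \<kappa> \<theta> r q \<Omega> u v z
      = ?a * (a * (s * v z)) + ?b * weak_dx \<Omega> u z * v z"
    by (simp add: heston_integrand3_def a_def s(1) algebra_simps)
  also have "\<dots> = ?a * (a * (s * v z)) + ?b * (a * w)"
    by (simp add: b)
  also have "\<bar>\<dots>\<bar> \<le> \<bar>?a\<bar> * (\<bar>a\<bar> * \<bar>s * v z\<bar>) + \<bar>?b\<bar> * (\<bar>a\<bar> * \<bar>w\<bar>)"
    by (rule order_trans[OF abs_triangle_ineq]) (simp add: abs_mult)
  also have "\<dots> \<le> \<bar>?a\<bar> * (P * Q) + \<bar>?b\<bar> * (P * \<bar>w\<bar>)"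
    using le by (intro add_mono mult_left_mono mult_mono) auto
  finally show ?thesis
    by (simp add: P_def Q_def)
qed

lemma heston_integrand4_le:
  assumes y: "0 \<le> snd z"
  shows "\<bar>heston_integrand4 r u v z\<bar>
    \<le> \<bar>r\<bar> * (sqrt (H1_density \<Omega> u z) * sqrt (H1_density \<Omega> v z))"
  unfolding heston_integrand4_def abs_mult mult.assoc
  using sqrt_H1_density_ge(4)[OF y] H1_density_nonneg[OF y]
  by (intro mult_left_mono mult_mono) auto


section \<open>Continuity of the Heston bilinear form\<close>

definition heston_form_bound :: "real \<Rightarrow> real \<Rightarrow> real \<Rightarrow> real \<Rightarrow> real \<Rightarrow> real \<Rightarrow> real \<Rightarrow> real" where
  "heston_form_bound \<sigma> \<rho> \<kappa> \<theta> r q \<gamma> =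
     1 / 2 * (1 + \<bar>\<sigma>\<bar>)\<^sup>2 + \<bar>\<gamma>\<bar> / 2 * (1 + \<bar>\<sigma>\<bar>) + \<bar>heston_a1 \<sigma> \<rho> \<kappa>\<bar>
     + \<bar>heston_b1 \<sigma> \<rho> \<kappa> \<theta> r q\<bar> + \<bar>r\<bar>"

lemma heston_form_bound_pos: "0 < heston_form_bound \<sigma> \<rho> \<kappa> \<theta> r q \<gamma>"
proof -
  have "0 < 1 / 2 * (1 + \<bar>\<sigma>\<bar>)\<^sup>2"
    by (simp add: add_pos_nonneg)
  then show ?thesis
    unfolding heston_form_bound_def by (intro add_pos_nonneg) auto
qed

lemma heston_form_bounded:
  fixes \<sigma> \<rho> \<kappa> \<theta> r q \<gamma> :: real and \<Omega> :: "(real \<times> real) set"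
  defines "M \<equiv> heston_measure \<sigma> \<kappa> \<theta> \<gamma> \<Omega>"
  assumes rho: "\<bar>\<rho>\<bar> \<le> 1" and \<Omega>: "\<Omega> \<subseteq> upper_half_plane"
    and u: "u \<in> H1_space M \<Omega>" and v: "v \<in> H1_space M \<Omega>" and w: "w \<in> L2_space M"
    and w_eq: "heston_b1 \<sigma> \<rho> \<kappa> \<theta> r q = 0 \<or> (\<forall>z\<in>\<Omega>. w z = snd z powr (- 1 / 2) * v z)"
  shows "heston_form_defined \<sigma> \<rho> \<kappa> \<theta> r q \<gamma> \<Omega> u v"
    and "\<bar>heston_form \<sigma> \<rho> \<kappa> \<theta> r q \<gamma> \<Omega> u v\<bar>
      \<le> heston_form_bound \<sigma> \<rho> \<kappa> \<theta> r q \<gamma> * H1_norm M \<Omega> u * (H1_norm M \<Omega> v + L2_norm M w)"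
proof -
  let ?P = "\<lambda>z. sqrt (H1_density \<Omega> u z)" and ?Q = "\<lambda>z. sqrt (H1_density \<Omega> v z)"
  let ?I1 = "heston_integrand1 \<sigma> \<rho> \<Omega> u v" and ?I2 = "heston_integrand2 \<sigma> \<rho> \<Omega> u v"
    and ?I3 = "heston_integrand3 \<sigma> \<rho> \<kappa> \<theta> r q \<Omega> u v" and ?I4 = "heston_integrand4 r u v"
  let ?a = "\<bar>heston_a1 \<sigma> \<rho> \<kappa>\<bar>" and ?b = "\<bar>heston_b1 \<sigma> \<rho> \<kappa> \<theta> r q\<bar>"
  have space: "space M = \<Omega>"
    by (simp add: M_def)
  have pos: "0 < snd z" if "z \<in> space M" for z
    using \<Omega> that by (auto simp: space upper_half_plane_def)
  note y0 = less_imp_le[OF pos]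
  note L2 = sqrt_H1_density_L2(1)[OF u y0] sqrt_H1_density_L2(1)[OF v y0] w
  have norms: "L2_norm M ?P = H1_norm M \<Omega> u" "L2_norm M ?Q = H1_norm M \<Omega> v"
    using sqrt_H1_density_L2(2)[OF u y0] sqrt_H1_density_L2(2)[OF v y0] by auto
  note [measurable] = H1_space_measurable[OF u] H1_space_measurable[OF v] coordinates_measurable
  have sgn_fst [measurable]: "(\<lambda>z. sgn (fst z)) \<in> borel_measurable (lebesgue_on \<Omega>)"
    by (rule measurable_compose[OF coordinates_measurable(1)]) simp
  have meas: "?I1 \<in> borel_measurable M" "?I2 \<in> borel_measurable M"
    "?I3 \<in> borel_measurable M" "?I4 \<in> borel_measurable M"
    unfolding M_def measurable_heston_measure heston_integrand1_def[abs_def]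
      heston_integrand2_def[abs_def] heston_integrand3_def[abs_def] heston_integrand4_def[abs_def]
    by measurable
  have PQ: "\<bar>?P z * ?Q z\<bar> = ?P z * ?Q z" and Pw: "\<bar>?P z * w z\<bar> = ?P z * \<bar>w z\<bar>"
    if "z \<in> space M" for z
    using H1_density_nonneg[OF y0[OF that]] by (simp_all add: abs_mult)
  have le1: "\<bar>?I1 z\<bar> \<le> (1 + \<bar>\<sigma>\<bar>)\<^sup>2 * \<bar>?P z * ?Q z\<bar> + 0 * \<bar>?P z * w z\<bar>"
    if "z \<in> space M" for z
    using heston_integrand1_le[OF y0[OF that] rho] PQ[OF that] by simp
  have le2: "\<bar>?I2 z\<bar> \<le> (1 + \<bar>\<sigma>\<bar>) * \<bar>?P z * ?Q z\<bar> + 0 * \<bar>?P z * w z\<bar>"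
    if "z \<in> space M" for z
    using heston_integrand2_le[OF y0[OF that] rho] PQ[OF that] by simp
  have le3: "\<bar>?I3 z\<bar> \<le> ?a * \<bar>?P z * ?Q z\<bar> + ?b * \<bar>?P z * w z\<bar>"
    if "z \<in> space M" for z
  proof -
    have "heston_b1 \<sigma> \<rho> \<kappa> \<theta> r q = 0 \<or> w z = snd z powr (- 1 / 2) * v z"
      using w_eq that space by auto
    from heston_integrand3_le[where v = v and w = "w z", OF pos[OF that] this] show ?thesis
      unfolding PQ[OF that] Pw[OF that] .
  qed
  have le4: "\<bar>?I4 z\<bar> \<le> \<bar>r\<bar> * \<bar>?P z * ?Q z\<bar> + 0 * \<bar>?P z * w z\<bar>"
    if "z \<in> space M" for z
    using heston_integrand4_le[OF y0[OF that]] PQ[OF that] by simp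
  have c_nonneg: "0 \<le> (1 + \<bar>\<sigma>\<bar>)\<^sup>2" "0 \<le> 1 + \<bar>\<sigma>\<bar>"
    by auto
  note b1 = integral_bound_by_products[OF L2 meas(1) le1 c_nonneg(1) order_refl]
  note b2 = integral_bound_by_products[OF L2 meas(2) le2 c_nonneg(2) order_refl]
  note b3 = integral_bound_by_products[OF L2 meas(3) le3 abs_ge_zero abs_ge_zero]
  note b4 = integral_bound_by_products[OF L2 meas(4) le4 abs_ge_zero order_refl]
  show "heston_form_defined \<sigma> \<rho> \<kappa> \<theta> r q \<gamma> \<Omega> u v"
    unfolding heston_form_defined_def Let_def M_def[symmetric]
    using b1(1) b2(1) b3(1) b4(1) by blast
  define U where "U = H1_norm M \<Omega> u"
  define V where "V = H1_norm M \<Omega> v"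
  define W where "W = L2_norm M w"
  have nonneg: "0 \<le> U" "0 \<le> V" "0 \<le> W"
    using L2_norm_nonneg[of M ?P] L2_norm_nonneg[of M ?Q] L2_norm_nonneg[of M w]
    by (simp_all add: norms U_def V_def W_def)
  have distrib: "U * (c * V + d * W) = c * (U * V) + d * (U * W)" for c d
    by (simp add: algebra_simps)
  note i = b1(2) b2(2) b3(2) b4(2)
  note i = i[unfolded norms, folded U_def V_def W_def, unfolded distrib]
  define K where "K = 1 / 2 * (1 + \<bar>\<sigma>\<bar>)\<^sup>2 + \<bar>\<gamma>\<bar> / 2 * (1 + \<bar>\<sigma>\<bar>) + ?a + \<bar>r\<bar>"
  have "\<bar>heston_form \<sigma> \<rho> \<kappa> \<theta> r q \<gamma> \<Omega> u v\<bar>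
      \<le> 1 / 2 * \<bar>LINT z|M. ?I1 z\<bar> + \<bar>\<gamma>\<bar> / 2 * \<bar>LINT z|M. ?I2 z\<bar>
        + \<bar>LINT z|M. ?I3 z\<bar> + \<bar>LINT z|M. ?I4 z\<bar>"
  proof -
    have tri: "\<bar>1 / 2 * x1 - \<gamma> / 2 * x2 - x3 + x4\<bar>
        \<le> 1 / 2 * \<bar>x1\<bar> + \<bar>\<gamma>\<bar> / 2 * \<bar>x2\<bar> + \<bar>x3\<bar> + \<bar>x4\<bar>" for x1 x2 x3 x4 :: real
    proof -
      have "\<bar>\<gamma> / 2 * x2\<bar> = \<bar>\<gamma>\<bar> / 2 * \<bar>x2\<bar>"
        by (simp add: abs_mult)
      then show ?thesis
        by linarith
    qed
    show ?thesis
      unfolding heston_form_def Let_def M_def[symmetric] by (rule tri)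
  qed
  also have "\<dots> \<le> 1 / 2 * ((1 + \<bar>\<sigma>\<bar>)\<^sup>2 * (U * V) + 0 * (U * W))
        + \<bar>\<gamma>\<bar> / 2 * ((1 + \<bar>\<sigma>\<bar>) * (U * V) + 0 * (U * W))
        + (?a * (U * V) + ?b * (U * W)) + (\<bar>r\<bar> * (U * V) + 0 * (U * W))"
    by (intro add_mono mult_left_mono i) auto
  also have "\<dots> = K * (U * V) + ?b * (U * W)"
    by (simp add: K_def algebra_simps)
  also have "\<dots> \<le> (K + ?b) * (U * V) + (K + ?b) * (U * W)"
  proof (intro add_mono mult_right_mono)
    show "K \<le> K + ?b" "?b \<le> K + ?b"
      by (simp_all add: K_def)
  qed (use nonneg in auto)
  also have "\<dots> = (K + ?b) * U * (V + W)"
    by (simp add: algebra_simps)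
  also have "K + ?b = heston_form_bound \<sigma> \<rho> \<kappa> \<theta> r q \<gamma>"
    by (simp add: K_def heston_form_bound_def)
  finally show "\<bar>heston_form \<sigma> \<rho> \<kappa> \<theta> r q \<gamma> \<Omega> u v\<bar>
      \<le> heston_form_bound \<sigma> \<rho> \<kappa> \<theta> r q \<gamma> * H1_norm M \<Omega> u * (H1_norm M \<Omega> v + L2_norm M w)"
    by (simp add: U_def V_def W_def)
qed

theorem proposition2p40:
  fixes \<sigma> \<rho> \<kappa> \<theta> r q \<gamma> :: real
  assumes "\<sigma> \<noteq> 0" and "-1 < \<rho>" and "\<rho> < 1" and "\<kappa> > 0" and "\<theta> > 0"
    and "r \<ge> 0" and "q \<ge> 0" and "\<gamma> \<ge> 0"
  shows "\<exists>C\<^sub>5>0. \<forall>\<Omega>. heston_domain \<Omega> \<longrightarrow>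
    (let M = heston_measure \<sigma> \<kappa> \<theta> \<gamma> \<Omega>;
         a = heston_form \<sigma> \<rho> \<kappa> \<theta> r q \<gamma> \<Omega>;
         a_defined = heston_form_defined \<sigma> \<rho> \<kappa> \<theta> r q \<gamma> \<Omega>
     in \<forall>u\<in>H1_space M \<Omega>. \<forall>v\<in>H1_space M \<Omega>.
       ((\<lambda>z. snd z powr (- 1 / 2) * v z) \<in> L2_space M \<longrightarrow>
          a_defined u v \<and>
          \<bar>a u v\<bar> \<le> C\<^sub>5 * H1_norm M \<Omega> u *
            (H1_norm M \<Omega> v + L2_norm M (\<lambda>z. snd z powr (- 1 / 2) * v z))) \<and>
       (heston_b1 \<sigma> \<rho> \<kappa> \<theta> r q = 0 \<longrightarrow>
          a_defined u v \<and>
          \<bar>a u v\<bar> \<le> C\<^sub>5 * H1_norm M \<Omega> u * H1_norm M \<Omega> v))"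
proof (intro exI[of _ "heston_form_bound \<sigma> \<rho> \<kappa> \<theta> r q \<gamma>"] conjI allI impI
    heston_form_bound_pos)
  fix \<Omega> assume "heston_domain \<Omega>"
  then have \<Omega>: "\<Omega> \<subseteq> upper_half_plane"
    by (simp add: heston_domain_def)
  have rho: "\<bar>\<rho>\<bar> \<le> 1"
    using assms by auto
  let ?M = "heston_measure \<sigma> \<kappa> \<theta> \<gamma> \<Omega>"
  have zero: "(\<lambda>z. 0) \<in> L2_space ?M" "L2_norm ?M (\<lambda>z. 0) = 0"
    by (simp_all add: L2_space_def L2_norm_def)
  note bounded = heston_form_bounded[OF rho \<Omega>]
  show "let M = ?M;
         a = heston_form \<sigma> \<rho> \<kappa> \<theta> r q \<gamma> \<Omega>;
         a_defined = heston_form_defined \<sigma> \<rho> \<kappa> \<theta> r q \<gamma> \<Omega>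
     in \<forall>u\<in>H1_space M \<Omega>. \<forall>v\<in>H1_space M \<Omega>.
       ((\<lambda>z. snd z powr (- 1 / 2) * v z) \<in> L2_space M \<longrightarrow>
          a_defined u v \<and>
          \<bar>a u v\<bar> \<le> heston_form_bound \<sigma> \<rho> \<kappa> \<theta> r q \<gamma> * H1_norm M \<Omega> u *
            (H1_norm M \<Omega> v + L2_norm M (\<lambda>z. snd z powr (- 1 / 2) * v z))) \<and>
       (heston_b1 \<sigma> \<rho> \<kappa> \<theta> r q = 0 \<longrightarrow>
          a_defined u v \<and>
          \<bar>a u v\<bar> \<le> heston_form_bound \<sigma> \<rho> \<kappa> \<theta> r q \<gamma> * H1_norm M \<Omega> u * H1_norm M \<Omega> v)"
    unfolding Let_def
  proof (intro ballI conjI impI)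
    fix u v
    assume uv: "u \<in> H1_space ?M \<Omega>" "v \<in> H1_space ?M \<Omega>"
    {
      assume w: "(\<lambda>z. snd z powr (- 1 / 2) * v z) \<in> L2_space ?M"
      show "heston_form_defined \<sigma> \<rho> \<kappa> \<theta> r q \<gamma> \<Omega> u v"
        by (rule bounded(1)[OF uv w]) simp
      show "\<bar>heston_form \<sigma> \<rho> \<kappa> \<theta> r q \<gamma> \<Omega> u v\<bar>
        \<le> heston_form_bound \<sigma> \<rho> \<kappa> \<theta> r q \<gamma> * H1_norm ?M \<Omega> u *
          (H1_norm ?M \<Omega> v + L2_norm ?M (\<lambda>z. snd z powr (- 1 / 2) * v z))"
        by (rule bounded(2)[OF uv w]) simp
    next
      assume b1: "heston_b1 \<sigma> \<rho> \<kappa> \<theta> r q = 0"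
      show "heston_form_defined \<sigma> \<rho> \<kappa> \<theta> r q \<gamma> \<Omega> u v"
        by (rule bounded(1)[OF uv zero(1)]) (simp add: b1)
      have "\<bar>heston_form \<sigma> \<rho> \<kappa> \<theta> r q \<gamma> \<Omega> u v\<bar>
        \<le> heston_form_bound \<sigma> \<rho> \<kappa> \<theta> r q \<gamma> * H1_norm ?M \<Omega> u *
          (H1_norm ?M \<Omega> v + L2_norm ?M (\<lambda>z. 0))"
        by (rule bounded(2)[OF uv zero(1)]) (simp add: b1)
      then show "\<bar>heston_form \<sigma> \<rho> \<kappa> \<theta> r q \<gamma> \<Omega> u v\<bar>
        \<le> heston_form_bound \<sigma> \<rho> \<kappa> \<theta> r q \<gamma> * H1_norm ?M \<Omega> u * H1_norm ?M \<Omega> v"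
        by (simp add: zero(2))
    }
  qed
qed

end
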